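(* Fix an integer $k\geq 3$. Let $\alpha\in\mathbb{F}_2^k$ be such that neither $\alpha$ nor $\alpha+\mathbf{1}$ belongs to the set \[ \{\mathbf{0},\ (1,0,\ldots,0),\ (1,0,1,0,\ldots),\ (0,0,1,0,1,0,\ldots)\}\subset\mathbb{F}_2^k. \] Then $f_\alpha(n)=O(\sqrt{n})$ as a function of $n$.
   Context: Write $[n]=\{1,2,\ldots,n\}$ and let $2^{[n]}$ be the collection of all subsets of $[n]$. For $\alpha=(\alpha_1,\ldots,\alpha_k)\in\mathbb{F}_2^k$, a collection $\mathcal{F}\subset 2^{[n]}$ satisfies $\alpha$-intersection pattern modulo $2$ if, for every $1\le i\le k$, $|F_1\cap\cdots\cap F_i|\equiv\alpha_i \pmod 2$ for all (pairwise) distinct $F_1,\ldots,F_i\in\mathcal{F}$. Let $f_\alpha(n)$ denote the maximum size of a family $\mathcal{F}\subset 2^{[n]}$ satisfying $\alpha$-intersection pattern modulo $2$. Here $\mathbf{0}$ and $\mathbf{1}$ are the all-zeros and all-ones vectors in $\mathbb{F}_2^k$; $(1,0,\ldots,0)$ has first coordinate $1$ and all others $0$; $(1,0,1,0,\ldots)$ is the length-$k$ vector whose $i$th coordinate is $1$ exactly when $i$ is odd; and $(0,0,1,0,1,0,\ldots)$ is the length-$k$ vector whose $i$th coordinate is $1$ exactly when $i$ is odd and $i\ge 3$. The notation $f=O(g)$ means there is a constant $c>0$ with $f(n)\le c\,g(n)$ for all positive integers $n$. *)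

theory Defs
  imports Complex_Main "HOL-Library.FuncSet" "HOL-Library.Z2"
begin

text \<open>Vectors of length \<open>k\<close> over the two-element field, with coordinates indexed by \<open>1, \<dots>, k\<close>
  and the value \<open>undefined\<close> outside, so that HOL equality is equality of vectors.\<close>

abbreviation F2vecs :: "nat \<Rightarrow> (nat \<Rightarrow> bit) set" where
  "F2vecs k \<equiv> {1..k} \<rightarrow>\<^sub>E UNIV"

definition vec_add :: "nat \<Rightarrow> (nat \<Rightarrow> bit) \<Rightarrow> (nat \<Rightarrow> bit) \<Rightarrow> (nat \<Rightarrow> bit)" where
  "vec_add k a b = (\<lambda>i\<in>{1..k}. a i + b i)"

definition zeros :: "nat \<Rightarrow> nat \<Rightarrow> bit" where
  "zeros k = (\<lambda>i\<in>{1..k}. 0)"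

definition ones :: "nat \<Rightarrow> nat \<Rightarrow> bit" where
  "ones k = (\<lambda>i\<in>{1..k}. 1)"

definition first_unit :: "nat \<Rightarrow> nat \<Rightarrow> bit" where
  "first_unit k = (\<lambda>i\<in>{1..k}. if i = 1 then 1 else 0)"

definition odd_ones :: "nat \<Rightarrow> nat \<Rightarrow> bit" where
  "odd_ones k = (\<lambda>i\<in>{1..k}. if odd i then 1 else 0)"

definition odd_ones_from_3 :: "nat \<Rightarrow> nat \<Rightarrow> bit" where
  "odd_ones_from_3 k = (\<lambda>i\<in>{1..k}. if odd i \<and> 3 \<le> i then 1 else 0)"

text \<open>The cast \<open>of_nat\<close> into \<^typ>\<open>bit\<close> is reduction modulo 2. The tuple of pairwise distinct
  members \<open>F\<^sub>1, \<dots>, F\<^sub>i\<close> is an injective function on \<open>{1..i}\<close>.\<close>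

definition satisfies_pattern :: "nat \<Rightarrow> (nat \<Rightarrow> bit) \<Rightarrow> 'a set set \<Rightarrow> bool" where
  "satisfies_pattern k \<alpha> \<F> \<longleftrightarrow>
     (\<forall>i\<in>{1..k}. \<forall>F \<in> {1..i} \<rightarrow> \<F>. inj_on F {1..i} \<longrightarrow>
        of_nat (card (\<Inter>j\<in>{1..i}. F j)) = \<alpha> i)"

definition pattern_families :: "nat \<Rightarrow> (nat \<Rightarrow> bit) \<Rightarrow> nat \<Rightarrow> nat set set set" where
  "pattern_families k \<alpha> n = {\<F>. \<F> \<subseteq> Pow {1..n} \<and> satisfies_pattern k \<alpha> \<F>}"

definition max_pattern_size :: "nat \<Rightarrow> (nat \<Rightarrow> bit) \<Rightarrow> nat \<Rightarrow> nat" where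
  "max_pattern_size k \<alpha> n = Max (card ` pattern_families k \<alpha> n)"

text \<open>The maximum is taken over a finite nonempty set, so it is attained.\<close>

lemma finite_pattern_families: "finite (pattern_families k \<alpha> n)"
  unfolding pattern_families_def by (rule finite_subset[of _ "Pow (Pow {1..n})"]) auto

lemma empty_in_pattern_families: "{} \<in> pattern_families k \<alpha> n"
  by (auto simp: pattern_families_def satisfies_pattern_def Pi_iff)

end

theory Submission imports Defs begin

text \<open>
  The hypotheses exclude exactly the vectors with \<open>\<alpha> i = \<alpha> (i + 2)\<close> for all \<open>2 \<le> i \<le> k - 2\<close>: such a
  vector is determined by its first three coordinates, and the four listed vectors together with
  their complements are the eight possibilities. So some \<open>p\<close> has
  \<open>\<alpha> (p + 2) \<noteq> \<alpha> (p + 4)\<close> and \<open>p + 4 \<le> k\<close> (\<open>pattern_change\<close>).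

  Given a family \<open>\<F>\<close>, fix \<open>p\<close> members \<open>C\<close> of it, let \<open>R\<close> be the rest, and attach to each
  two-element \<open>e \<subseteq> R\<close> the set \<open>\<Inter>(C \<union> e)\<close>. These are about \<open>|R|\<^sup>2 / 2\<close> vectors in \<open>\<F>\<^sub>2\<^sup>n\<close>, and the pattern
  determines their inner products: they are \<open>\<alpha> (p + |e \<union> f|)\<close>, so the Gram matrix is
  \<open>(\<alpha> (p + 2) + \<alpha> (p + 4)) I + (\<alpha> (p + 3) + \<alpha> (p + 4)) B\<^sup>TB + \<alpha> (p + 4) J\<close>,
  where \<open>B\<close> is the incidence matrix of the elements of \<open>R\<close> against the pairs and \<open>J\<close> is the all-ones
  matrix. The first coefficient is \<open>1\<close>, and the other two terms have rank at most \<open>|R| + 1\<close>. Hence the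
  rank is at least \<open>|R| (|R| - 1) / 2 - |R| - 1\<close>; it is at most \<open>n\<close>, so \<open>|R| = O(\<surd>n)\<close>.

  In place of ranks, each pair \<open>e\<close> gets a vector with \<open>n + |R| + 1\<close> coordinates: the set
  \<open>\<Inter>(C \<union> e)\<close>, the set \<open>e\<close> itself, and a constant \<open>1\<close>. A set \<open>D\<close> of pairs whose vectors sum to zero is
  annihilated by both low-rank terms, so the Gram matrix acts on it as the identity, and \<open>D\<close> is empty
  (\<open>dependent_pairs_empty\<close>). Independence of the vectors is then a bound on their number
  (\<open>card_le_if_independent\<close>).
\<close>

section \<open>Linear algebra over the two-element field in terms of sets\<close>

lemma even_card_sym_diff:
  assumes "finite A" "finite B"
  shows "even (card ((A - B) \<union> (B - A))) \<longleftrightarrow> (even (card A) \<longleftrightarrow> even (card B))"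
proof -
  have "card A = card (A - B) + card (A \<inter> B)" "card B = card (B - A) + card (A \<inter> B)"
    using assms by (simp_all add: card_Int_Diff[of A B] card_Int_Diff[of B A] Int_commute)
  moreover have "card ((A - B) \<union> (B - A)) = card (A - B) + card (B - A)"
    using assms by (intro card_Un_disjoint) auto
  ultimately show ?thesis by auto
qed

text \<open>The premise is linear independence over \<open>\<F>\<^sub>2\<close> of the vectors \<open>P e\<close> indexed by \<open>e \<in> E\<close>: a
  linear combination is the choice of a subset \<open>D\<close>, and the sum has a nonzero coordinate at \<open>x\<close> iff an
  odd number of \<open>e \<in> D\<close> have \<open>P e x\<close>. The map from combinations to their sums is then injective, and
  it goes from \<open>2 ^ card E\<close> to \<open>2 ^ card U\<close> objects.\<close>

lemma card_le_if_independent: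
  assumes E: "finite E" and U: "finite U"
    and indep: "\<And>D. D \<subseteq> E \<Longrightarrow> D \<noteq> {} \<Longrightarrow> \<exists>x\<in>U. odd (card {e\<in>D. P e x})"
  shows "card E \<le> card U"
proof -
  define \<phi> where "\<phi> D = {x\<in>U. odd (card {e\<in>D. P e x})}" for D
  have "inj_on \<phi> (Pow E)"
  proof (rule inj_onI)
    fix S T assume ST: "S \<in> Pow E" "T \<in> Pow E" and eq: "\<phi> S = \<phi> T"
    define D where "D = (S - T) \<union> (T - S)"
    have "even (card {e\<in>D. P e x})" if "x \<in> U" for x
    proof -
      have fin: "finite {e\<in>S. P e x}" "finite {e\<in>T. P e x}"
        using ST E by (auto intro: finite_subset)
      have "{e\<in>D. P e x} = ({e\<in>S. P e x} - {e\<in>T. P e x}) \<union> ({e\<in>T. P e x} - {e\<in>S. P e x})"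
        by (auto simp: D_def)
      moreover have "even (card {e\<in>S. P e x}) \<longleftrightarrow> even (card {e\<in>T. P e x})"
        using eq that by (auto simp: \<phi>_def set_eq_iff)
      ultimately show ?thesis using even_card_sym_diff[OF fin] by simp
    qed
    moreover have "D \<subseteq> E" using ST by (auto simp: D_def)
    ultimately have "D = {}" using indep by blast
    then show "S = T" by (auto simp: D_def)
  qed
  moreover have "\<phi> ` Pow E \<subseteq> Pow U" by (auto simp: \<phi>_def)
  ultimately have "card (Pow E) \<le> card (Pow U)"
    using U by (meson card_inj_on_le finite_Pow_iff)
  then show ?thesis using E U by (simp add: card_Pow)
qed

lemma of_nat_bit_eq_0_iff: "(of_nat n :: bit) = 0 \<longleftrightarrow> even n"
  by (induction n) auto

text \<open>Taking the inner product with \<open>Y\<close> is linear, so it suffices that the vectors \<open>X e\<close> sum to zero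
  on the coordinates in \<open>Y\<close>.\<close>

lemma sum_card_Int_bit_eq_0:
  assumes D: "finite D" and Y: "finite Y"
    and even: "\<And>x. x \<in> Y \<Longrightarrow> even (card {e\<in>D. x \<in> X e})"
  shows "(\<Sum>e\<in>D. of_nat (card (X e \<inter> Y))) = (0 :: bit)"
proof -
  have "(\<Sum>e\<in>D. card (X e \<inter> Y)) = (\<Sum>e\<in>D. \<Sum>x\<in>Y. if x \<in> X e then 1 else 0)"
    using Y by (simp add: sum.If_cases Int_commute Collect_conj_eq)
  also have "\<dots> = (\<Sum>x\<in>Y. \<Sum>e\<in>D. if x \<in> X e then 1 else 0)" by (rule sum.swap)
  also have "\<dots> = (\<Sum>x\<in>Y. card {e\<in>D. x \<in> X e})"
    using D by (simp add: sum.If_cases Collect_conj_eq)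
  finally have "even (\<Sum>e\<in>D. card (X e \<inter> Y))" using even by (simp add: dvd_sum)
  then show ?thesis by (simp flip: of_nat_sum add: of_nat_bit_eq_0_iff)
qed

section \<open>Intersections along pairs\<close>

lemma satisfies_patternD:
  assumes pat: "satisfies_pattern k \<alpha> \<F>" and S: "S \<subseteq> \<F>" "card S \<in> {1..k}"
  shows "of_nat (card (\<Inter>S)) = \<alpha> (card S)"
proof -
  have "finite S" using S by (auto intro: card_ge_0_finite)
  then obtain F where F: "bij_betw F {1..card S} S"
    using ex_bij_betw_nat_finite_1 by blast
  then have im: "F ` {1..card S} = S" and inj: "inj_on F {1..card S}"
    by (auto simp: bij_betw_def)
  have "F \<in> {1..card S} \<rightarrow> \<F>" using im S by auto
  then have "of_nat (card (\<Inter>j\<in>{1..card S}. F j)) = \<alpha> (card S)"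
    using pat S inj unfolding satisfies_pattern_def by blast
  then show ?thesis using im by simp
qed

definition pairs :: "'a set \<Rightarrow> 'a set set" where
  "pairs R = {e. e \<subseteq> R \<and> card e = 2}"

text \<open>This splits the Gram matrix into multiples of \<open>I\<close>, \<open>B\<^sup>TB\<close> and \<open>J\<close>. Disjoint pairs fix the
  coefficient of \<open>J\<close>, pairs that meet in one element that of \<open>B\<^sup>TB\<close>, and then the diagonal that of \<open>I\<close>,
  because the diagonal of \<open>B\<^sup>TB\<close> is \<open>2 = 0\<close>.\<close>

lemma gram_entry:
  fixes \<alpha> :: "nat \<Rightarrow> bit"
  assumes "card e = 2" "card f = 2"
  shows "\<alpha> (p + card (e \<union> f)) = (if e = f then \<alpha> (p + 2) + \<alpha> (p + 4) else 0)
           + (\<alpha> (p + 3) + \<alpha> (p + 4)) * of_nat (card (e \<inter> f)) + \<alpha> (p + 4)"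
proof -
  have fin: "finite e" "finite f" using assms by (auto intro: card_ge_0_finite)
  have un: "card (e \<union> f) + card (e \<inter> f) = 4"
    using card_Un_Int[OF fin] assms by simp
  show ?thesis
  proof (cases "e = f")
    case True
    have "a = a + b + c * 0 + b" for a b c :: bit by (cases b; cases a) simp_all
    from this[of "\<alpha> (p + 2)" "\<alpha> (p + 4)" "\<alpha> (p + 3) + \<alpha> (p + 4)"] show ?thesis
      by (simp only: True assms Int_absorb Un_absorb if_True of_nat_numeral bit_2_eq_0 refl)
  next
    case False
    have "card (e \<inter> f) \<noteq> 2"
    proof
      assume "card (e \<inter> f) = 2"
      then have "e \<inter> f = e" "e \<inter> f = f"
        using assms card_subset_eq[OF fin(1) Int_lower1] card_subset_eq[OF fin(2) Int_lower2] by metis+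
      then show False using False by auto
    qed
    moreover have "card (e \<inter> f) \<le> 2"
      using card_mono[of e "e \<inter> f"] fin assms by auto
    ultimately consider "card (e \<inter> f) = 0" | "card (e \<inter> f) = 1" by linarith
    then show ?thesis
    proof cases
      case 1
      then have "card (e \<union> f) = 4" using un by simp
      with 1 False show ?thesis by simp
    next
      case 2
      then have "card (e \<union> f) = 3" using un by simp
      with 2 False show ?thesis by (cases "\<alpha> (p + 4)"; cases "\<alpha> (p + 3)") simp_all
    qed
  qed
qed

text \<open>Row \<open>f\<close> of the Gram matrix, applied to the combination \<open>D\<close>, gives zero. The last two premises
  make the contributions of \<open>B\<^sup>TB\<close> and \<open>J\<close> vanish, so only the entry of the identity matrix remains and
  \<open>f\<close> is not in \<open>D\<close>.\<close>

lemma dependent_pairs_empty: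
  assumes pat: "satisfies_pattern k \<alpha> \<F>" and fin: "finite \<F>" "\<And>A. A \<in> \<F> \<Longrightarrow> finite A"
    and p: "p + 4 \<le> k" "\<alpha> (p + 2) \<noteq> \<alpha> (p + 4)"
    and C: "C \<subseteq> \<F>" "card C = p"
    and D: "D \<subseteq> pairs (\<F> - C)"
    and points: "\<And>x. x \<in> \<Union>\<F> \<Longrightarrow> even (card {e\<in>D. x \<in> \<Inter>(C \<union> e)})"
    and degrees: "\<And>A. A \<in> \<F> - C \<Longrightarrow> even (card {e\<in>D. A \<in> e})"
    and size: "even (card D)"
  shows "D = {}"
proof (rule ccontr)
  assume "D \<noteq> {}"
  then obtain f where f: "f \<in> D" by blast
  have finC: "finite C" using C fin by (auto intro: finite_subset)
  have finD: "finite D"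
    by (rule finite_subset[of _ "Pow \<F>"]) (use D fin in \<open>auto simp: pairs_def\<close>)
  have pair: "e \<subseteq> \<F> - C" "card e = 2" "finite e" if "e \<in> D" for e
  proof -
    show "e \<subseteq> \<F> - C" "card e = 2" using that D by (auto simp: pairs_def)
    then show "finite e" by (intro card_ge_0_finite) simp
  qed
  obtain A where A: "A \<in> f" using pair[OF f] by fastforce
  then have A': "A \<in> \<F>" using pair[OF f] by auto
  have entry: "of_nat (card (\<Inter>(C \<union> e) \<inter> \<Inter>(C \<union> f))) = \<alpha> (p + card (e \<union> f))" if e: "e \<in> D" for e
  proof -
    have "card (C \<union> (e \<union> f)) = p + card (e \<union> f)"
      using C finC pair[OF e] pair[OF f] by (subst card_Un_disjoint) auto
    moreover have "card (e \<union> f) \<le> 4" using card_Un_le[of e f] pair[OF e] pair[OF f] by simp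
    moreover have "2 \<le> card (e \<union> f)"
      using card_mono[of "e \<union> f" e] pair[OF e] pair[OF f] by simp
    moreover have "C \<union> (e \<union> f) \<subseteq> \<F>" using C pair[OF e] pair[OF f] by auto
    moreover have "\<Inter>(C \<union> e) \<inter> \<Inter>(C \<union> f) = \<Inter>(C \<union> (e \<union> f))" by auto
    ultimately show ?thesis using satisfies_patternD[OF pat, of "C \<union> (e \<union> f)"] p by simp
  qed
  have "(0 :: bit) = (\<Sum>e\<in>D. of_nat (card (\<Inter>(C \<union> e) \<inter> \<Inter>(C \<union> f))))"
  proof (rule sum_card_Int_bit_eq_0[symmetric])
    show "finite (\<Inter>(C \<union> f))" using A fin(2)[OF A'] by (auto intro: finite_subset[of _ A])
    show "even (card {e\<in>D. x \<in> \<Inter>(C \<union> e)})" if "x \<in> \<Inter>(C \<union> f)" for x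
      using points that A A' by blast
  qed (rule finD)
  also have "\<dots> = (\<Sum>e\<in>D. (if e = f then \<alpha> (p + 2) + \<alpha> (p + 4) else 0)
           + (\<alpha> (p + 3) + \<alpha> (p + 4)) * of_nat (card (e \<inter> f)) + \<alpha> (p + 4))"
    using pair f by (intro sum.cong refl trans[OF entry gram_entry[where p = p and f = f and \<alpha> = \<alpha>]])
  also have "\<dots> = (\<Sum>e\<in>D. if e = f then \<alpha> (p + 2) + \<alpha> (p + 4) else 0)
           + (\<alpha> (p + 3) + \<alpha> (p + 4)) * (\<Sum>e\<in>D. of_nat (card (e \<inter> f))) + of_nat (card D) * \<alpha> (p + 4)"
    by (simp only: sum.distrib sum_distrib_left sum_constant)
  also have "(\<Sum>e\<in>D. of_nat (card (e \<inter> f))) = (0 :: bit)"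
    using pair[OF f] degrees finD by (intro sum_card_Int_bit_eq_0) auto
  also have "of_nat (card D) = (0 :: bit)" using size by (simp add: of_nat_bit_eq_0_iff)
  finally have "\<alpha> (p + 2) + \<alpha> (p + 4) = 0"
    using f finD by (simp only: sum.delta if_True mult_zero_left mult_zero_right add_0_right)
  then show False using p(2) by (cases "\<alpha> (p + 2)"; cases "\<alpha> (p + 4)") auto
qed

lemma pairs_le:
  assumes pat: "satisfies_pattern k \<alpha> \<F>" and sub: "\<F> \<subseteq> Pow V" and V: "finite V"
    and p: "p + 4 \<le> k" "\<alpha> (p + 2) \<noteq> \<alpha> (p + 4)"
    and C: "C \<subseteq> \<F>" "card C = p"
  shows "card (\<F> - C) choose 2 \<le> card V + card (\<F> - C) + 1"
proof -
  have finF: "finite \<F>" using sub V by (auto intro: finite_subset)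
  \<comment> \<open>Three blocks of coordinates: the vector of \<open>e\<close> is \<open>\<Inter>(C \<union> e)\<close>, then \<open>e\<close>, then a constant \<open>1\<close>.\<close>
  define U where "U = V <+> ((\<F> - C) <+> {()})"
  define P where "P e = case_sum (\<lambda>x. x \<in> \<Inter>(C \<union> e)) (case_sum (\<lambda>A. A \<in> e) (\<lambda>_::unit. True))" for e
  have "card (pairs (\<F> - C)) \<le> card U"
  proof (rule card_le_if_independent[of _ _ P])
    show "finite (pairs (\<F> - C))" using finF by (simp add: pairs_def)
    show "finite U" using finF V by (simp add: U_def)
    fix D assume D: "D \<subseteq> pairs (\<F> - C)" "D \<noteq> {}"
    \<comment> \<open>If the vectors in \<open>D\<close> sum to zero, each block gives one of the three parity conditions.\<close>
    show "\<exists>x\<in>U. odd (card {e\<in>D. P e x})"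
    proof (rule ccontr)
      assume "\<not> (\<exists>x\<in>U. odd (card {e\<in>D. P e x}))"
      then have even: "even (card {e\<in>D. P e x})" if "x \<in> U" for x using that by blast
      have "D = {}"
      proof (rule dependent_pairs_empty[OF pat finF _ p C D(1)])
        show "finite A" if "A \<in> \<F>" for A using that sub V by (auto intro: finite_subset)
        show "even (card {e\<in>D. x \<in> \<Inter>(C \<union> e)})" if "x \<in> \<Union>\<F>" for x
        proof -
          have "Inl x \<in> U" using that sub by (auto simp: U_def)
          from even[OF this] show ?thesis by (simp add: P_def)
        qed
        show "even (card {e\<in>D. A \<in> e})" if "A \<in> \<F> - C" for A
        proof -
          have "Inr (Inl A) \<in> U" using that by (auto simp: U_def)
          from even[OF this] show ?thesis by (simp add: P_def)
        qed
        have "Inr (Inr ()) \<in> U" by (auto simp: U_def)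
        from even[OF this] show "even (card D)" by (simp add: P_def)
      qed
      with D show False by blast
    qed
  qed
  moreover have "card (pairs (\<F> - C)) = card (\<F> - C) choose 2"
    using finF by (simp add: pairs_def n_subsets)
  moreover have "card U = card V + card (\<F> - C) + 1"
    using finF V by (simp add: U_def card_Plus)
  ultimately show ?thesis by simp
qed

section \<open>The square-root bound\<close>

lemma le_sqrt_if_choose_2_le:
  assumes le: "m choose 2 \<le> n + m + 1" and n: "n \<ge> 1"
  shows "real m \<le> 4 * sqrt (real n)"
proof (rule ccontr)
  assume "\<not> ?thesis"
  then have gt: "4 * sqrt (real n) < real m" by simp
  have "1 \<le> sqrt (real n)" using n by simp
  \<comment> \<open>From here \<open>3 m < (3/4) m\<^sup>2\<close> and \<open>4 n < m\<^sup>2 / 4\<close>, so the quadratic inequality below is violated.\<close>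
  then have m4: "4 < real m" using gt by linarith
  have "even (m * (m - 1))" by (cases m) auto
  then have "m * (m - 1) = 2 * (m choose 2)" by (simp add: choose_two)
  then have "m * (m - 1) \<le> 2 * (n + m + 1)" using le by simp
  then have "real (m * (m - 1)) \<le> real (2 * (n + m + 1))" by (rule of_nat_mono)
  moreover have "real (m * (m - 1)) = real m * (real m - 1)" using m4 by (simp add: of_nat_diff)
  ultimately have "real m * real m \<le> 3 * real m + 2 * real n + 2" by (simp add: algebra_simps)
  also have "\<dots> \<le> 3 * real m + 4 * real n" using n by simp
  finally have up: "real m * real m \<le> 3 * real m + 4 * real n" .
  have "(4 * sqrt (real n)) ^ 2 < real m ^ 2" using gt by (intro power_strict_mono) auto
  then have "16 * real n < real m * real m" by (simp add: power_mult_distrib power2_eq_square)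
  moreover have "4 * real m < real m * real m" using m4 by simp
  ultimately show False using up by linarith
qed

lemma family_size_bound:
  assumes pat: "satisfies_pattern k \<alpha> \<F>" and sub: "\<F> \<subseteq> Pow {1..n::nat}" and n: "n \<ge> 1"
    and p: "p + 4 \<le> k" "\<alpha> (p + 2) \<noteq> \<alpha> (p + 4)"
  shows "real (card \<F>) \<le> (real p + 4) * sqrt (real n)"
proof -
  have finF: "finite \<F>" using sub by (auto intro: finite_subset)
  have sq: "real p \<le> real p * sqrt (real n)" using n by (simp add: mult_le_cancel_left1)
  show ?thesis
  proof (cases "p \<le> card \<F>")
    case True
    then obtain C where C: "C \<subseteq> \<F>" "card C = p" by (meson obtain_subset_with_card_n)
    have "real (card (\<F> - C)) \<le> 4 * sqrt (real n)"
      using pairs_le[OF pat sub _ p C] n by (intro le_sqrt_if_choose_2_le) auto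
    moreover have "card \<F> = card (\<F> - C) + p"
      using C finF True by (simp add: card_Diff_subset finite_subset)
    ultimately show ?thesis using sq by (simp add: algebra_simps)
  next
    case False
    then have "real (card \<F>) \<le> real p" by simp
    also have "\<dots> \<le> (real p + 4) * sqrt (real n)" using sq by (simp add: algebra_simps add_increasing2)
    finally show ?thesis .
  qed
qed

section \<open>The exceptional patterns\<close>

text \<open>If no change occurs, then \<open>\<alpha>\<close> is constant on the even coordinates and constant on the odd ones
  from \<open>3\<close> on. The value on the even coordinates decides between \<open>\<alpha>\<close> and its complement; the values at
  \<open>1\<close> and at \<open>3\<close> then select one of the four vectors.\<close>

lemma pattern_change:
  assumes \<alpha>: "\<alpha> \<in> F2vecs k"
    and "\<alpha> \<notin> {zeros k, first_unit k, odd_ones k, odd_ones_from_3 k}"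
    and "vec_add k \<alpha> (ones k) \<notin> {zeros k, first_unit k, odd_ones k, odd_ones_from_3 k}"
  shows "\<exists>p. p + 4 \<le> k \<and> \<alpha> (p + 2) \<noteq> \<alpha> (p + 4)"
proof (rule ccontr)
  assume "\<not> ?thesis"
  then have step: "\<alpha> (p + 4) = \<alpha> (p + 2)" if "p + 4 \<le> k" for p using that by metis
  have rep: "i \<le> k \<longrightarrow> 2 \<le> i \<longrightarrow> \<alpha> i = (if even i then \<alpha> 2 else \<alpha> 3)" for i
  proof (induction i rule: less_induct)
    case (less i)
    show ?case
    proof (cases "i \<ge> 4")
      case True
      then obtain q where q: "i = q + 4" by (metis add.commute le_Suc_ex)
      show ?thesis using less[of "q + 2"] step[of q] by (auto simp: q)
    next
      case False
      then have "i < 2 \<or> i = 2 \<or> i = 3" by auto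
      then show ?thesis by auto
    qed
  qed
  define v where "v i = (if i = 1 then \<alpha> 1 else if even i then \<alpha> 2 else \<alpha> 3)" for i :: nat
  have val: "\<alpha> i = v i" if "i \<in> {1..k}" for i
    using rep[of i] that by (cases "i = 1") (auto simp: v_def)
  have eqI: "\<alpha> = (\<lambda>i\<in>{1..k}. g i)" if "\<And>i. v i = g i" for g
    using \<alpha> val that by (intro extensionalityI[of _ "{1..k}"]) (auto simp: PiE_def)
  have eqI': "vec_add k \<alpha> (ones k) = (\<lambda>i\<in>{1..k}. g i)" if "\<And>i. v i + 1 = g i" for g
    using val that by (auto simp: vec_add_def ones_def restrict_def fun_eq_iff)
  have odd3: "3 \<le> i" if "odd i" "i \<noteq> 1" for i :: nat using that by (cases "i = 2"; cases "i = 0") auto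
  have "\<alpha> \<in> {zeros k, first_unit k, odd_ones k, odd_ones_from_3 k}" if "\<alpha> 2 = 0"
  proof -
    have "\<alpha> = zeros k" if "\<alpha> 1 = 0" "\<alpha> 3 = 0"
      unfolding zeros_def using that \<open>\<alpha> 2 = 0\<close> by (intro eqI) (auto simp: v_def)
    moreover have "\<alpha> = first_unit k" if "\<alpha> 1 = 1" "\<alpha> 3 = 0"
      unfolding first_unit_def using that \<open>\<alpha> 2 = 0\<close> by (intro eqI) (auto simp: v_def)
    moreover have "\<alpha> = odd_ones k" if "\<alpha> 1 = 1" "\<alpha> 3 = 1"
      unfolding odd_ones_def using that \<open>\<alpha> 2 = 0\<close> by (intro eqI) (auto simp: v_def)
    moreover have "\<alpha> = odd_ones_from_3 k" if "\<alpha> 1 = 0" "\<alpha> 3 = 1"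
      unfolding odd_ones_from_3_def using that \<open>\<alpha> 2 = 0\<close> odd3 by (intro eqI) (auto simp: v_def)
    ultimately show ?thesis by (cases "\<alpha> 1"; cases "\<alpha> 3") blast+
  qed
  moreover have "vec_add k \<alpha> (ones k) \<in> {zeros k, first_unit k, odd_ones k, odd_ones_from_3 k}"
    if "\<alpha> 2 = 1"
  proof -
    have "vec_add k \<alpha> (ones k) = zeros k" if "\<alpha> 1 = 1" "\<alpha> 3 = 1"
      unfolding zeros_def using that \<open>\<alpha> 2 = 1\<close> by (intro eqI') (auto simp: v_def)
    moreover have "vec_add k \<alpha> (ones k) = first_unit k" if "\<alpha> 1 = 0" "\<alpha> 3 = 1"
      unfolding first_unit_def using that \<open>\<alpha> 2 = 1\<close> by (intro eqI') (auto simp: v_def)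
    moreover have "vec_add k \<alpha> (ones k) = odd_ones k" if "\<alpha> 1 = 0" "\<alpha> 3 = 0"
      unfolding odd_ones_def using that \<open>\<alpha> 2 = 1\<close> by (intro eqI') (auto simp: v_def)
    moreover have "vec_add k \<alpha> (ones k) = odd_ones_from_3 k" if "\<alpha> 1 = 1" "\<alpha> 3 = 0"
      unfolding odd_ones_from_3_def using that \<open>\<alpha> 2 = 1\<close> odd3 by (intro eqI') (auto simp: v_def)
    ultimately show ?thesis by (cases "\<alpha> 1"; cases "\<alpha> 3") blast+
  qed
  ultimately show False using assms(2,3) by (cases "\<alpha> 2") blast+
qed

theorem theorem3:
  fixes k :: nat and \<alpha> :: "nat \<Rightarrow> bit"
  assumes "k \<ge> 3"
    and "\<alpha> \<in> F2vecs k"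
    and "\<alpha> \<notin> {zeros k, first_unit k, odd_ones k, odd_ones_from_3 k}"
    and "vec_add k \<alpha> (ones k) \<notin> {zeros k, first_unit k, odd_ones k, odd_ones_from_3 k}"
  shows "\<exists>c::real. c > 0 \<and> (\<forall>n\<ge>1. real (max_pattern_size k \<alpha> n) \<le> c * sqrt (real n))"
proof -
  obtain p where p: "p + 4 \<le> k" "\<alpha> (p + 2) \<noteq> \<alpha> (p + 4)"
    using pattern_change[OF assms(2-4)] by blast
  have "real (max_pattern_size k \<alpha> n) \<le> (real p + 4) * sqrt (real n)" if n: "n \<ge> 1" for n
  proof -
    have "max_pattern_size k \<alpha> n \<in> card ` pattern_families k \<alpha> n"
      unfolding max_pattern_size_def
      using finite_pattern_families empty_in_pattern_families by (intro Max_in) blast+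
    then obtain \<F> where "\<F> \<in> pattern_families k \<alpha> n" "max_pattern_size k \<alpha> n = card \<F>" by blast
    then show ?thesis
      using family_size_bound[OF _ _ n p] by (auto simp: pattern_families_def)
  qed
  then show ?thesis by (intro exI[of _ "real p + 4"]) auto
qed

end
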